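(* Let $\lambda\in\mathbb{C}$, $f\in\mathcal{G}_0$, and let $G_r$ be its non-linear resolvent with $r>0$. Then $$|\Phi(G_r,\lambda)|=\frac{r}{(1+r)^5}|\Phi(f,\nu)|,\qquad\nu=(2-\lambda)\frac{r}{1+r}.$$ Consequently, (i) if $f\in\mathfrak{A}_\alpha$ with $\alpha\le1$, then $$|\Phi(G_r,\lambda)|\le\frac{r}{(1+r)^5}\max\left\{\frac{2}{3-2\alpha},\left|\frac{2}{3-2\alpha}-\frac{4}{(2-\alpha)^2}\cdot\frac{r}{1+r}(2-\lambda)\right|\right\};$$ (ii) if $f\in\mathfrak{A}^1_\alpha$ with $\alpha\le1$, then $$|\Phi(G_r,\lambda)|\le\frac{r}{(1+r)^5}\max\left(\frac{2-\alpha}{3-2\alpha},\ \frac{r}{1+r}|2-\lambda|\right);$$ (iii) if $f\in\mathfrak{R}_\alpha$ with $\alpha\in[0,1]$, then $$|\Phi(G_r,\lambda)|\le\frac{r}{(1+r)^5}\max\left\{\frac{1}{3-2\alpha},\left|\frac{1+r(\lambda-1)}{1+r}\right|\right\};$$ (iv) if $f\in\mathfrak{L}_\alpha$ with $\alpha<2$, then $$|\Phi(G_r,\lambda)|\le\frac{r}{(1+r)^5}\max\left\{\frac{1}{2-\alpha},\left|\frac{1+r(\lambda-1)}{1+r}\right|\right\};$$ (v) if $f\in\mathfrak{M}_\beta$ with $\beta<\frac32$, then $$|\Phi(G_r,\lambda)|\le\frac{r}{(1+r)^5}\max\left\{\frac{2-\beta}{6-4\beta},\left|\frac{1+r(\l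ambda-1)}{1+r}\right|\right\}.$$
   Context: Let $\mathbb{D}$ be the open unit disk. $\mathcal{A}$ is the set of holomorphic $f:\mathbb{D}\to\mathbb{C}$ with $f(0)=0$, $f'(0)=1$; quotients such as $f(z)/z$ and $zf'(z)/f(z)$ are extended by their limits at $0$. $\mathcal{G}_0=\{f\in\mathcal{A}:\operatorname{Re}(f(z)/z)>0,\ z\in\mathbb{D}\}$. For $f\in\mathcal{G}_0$ and $r>0$, the equation $w+rf(w)=z$ has for each $z\in\mathbb{D}$ a unique solution $w=G_r(z)\in\mathbb{D}$, and $G_r:\mathbb{D}\to\mathbb{D}$ is holomorphic; $G_r=(\mathrm{Id}+rf)^{-1}$ is the non-linear resolvent of $f$. For $h(z)=\sum_{n\ge0}c_nz^n$ holomorphic on $\mathbb{D}$ and $\lambda\in\mathbb{C}$, the Fekete–Szegő functional is $\Phi(h,\lambda)=c_1c_3-\lambda c_2^2$. Classes: - $\mathfrak{A}_\alpha=\{f\in\mathcal{A}:\operatorname{Re}[\alpha\frac{f(z)}{z}+(1-\alpha)f'(z)]\ge0,\ z\in\mathbb{D}\setminus\{0\}\}$. - $\mathfrak{A}^1_\alpha=\{f\in\mathcal{A}:|\alpha\frac{f(z)}{z}+(1-\alpha)f'(z)-1|\le2-\alpha,\ z\in\mathbb{D}\}$. - $\mathfrak{R}_\alpha$, $\alpha\in[0,1)$: all $f\in\mathcal{A}$ such that $g(z)=f(z)*\frac{z}{(1-z)^{2-2\alpha}}$ satisfies $\operatorname{Re}\frac{zg'(z)}{g(z)}\ge\alpha$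 on $\mathbb{D}$, where $*$ is the Hadamard (coefficientwise) product of power series; $\mathfrak{R}_1=\{f\in\mathcal{A}:\operatorname{Re}\frac{f(z)}{z}>\frac12,\ z\in\mathbb{D}\setminus\{0\}\}$. - $\mathfrak{L}_\alpha=\{f\in\mathcal{A}:\operatorname{Re}[\alpha\frac{f(z)}{z}+(1-\alpha)\frac{zf'(z)}{f(z)}]>\frac12,\ z\in\mathbb{D}\setminus\{0\}\}$. - $\mathfrak{M}_\beta$: all $f\in\mathcal{A}$ with $f(z)f'(z)\ne0$ for $z\in\mathbb{D}\setminus\{0\}$ and $\operatorname{Re}\left[\beta\frac{zf'(z)}{f(z)}+(1-\beta)\left(1+\frac{zf''(z)}{f'(z)}\right)\right]>\frac\beta2$ on $\mathbb{D}$. *)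

theory Defs
  imports "HOL-Complex_Analysis.Complex_Analysis"
begin

abbreviation unit_disc :: "complex set"
  where "unit_disc \<equiv> ball 0 1"

(* Extends a quotient q, whose defining formula is 0/0 at the origin, by its limit there. *)
definition ext0 :: "(complex \<Rightarrow> complex) \<Rightarrow> complex \<Rightarrow> complex"
  where "ext0 q z = (if z = 0 then Lim (at 0) q else q z)"

definition class_A :: "(complex \<Rightarrow> complex) set"
  where "class_A = {f. f holomorphic_on unit_disc \<and> f 0 = 0 \<and> deriv f 0 = 1}"

definition class_G0 :: "(complex \<Rightarrow> complex) set"
  where "class_G0 = {f \<in> class_A. \<forall>z\<in>unit_disc. Re (ext0 (\<lambda>z. f z / z) z) > 0}"

(* The definite description is meaningful on the unit disc for r > 0 and f in class_G0,
   where the equation has exactly one solution in the disc. *)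
definition nonlinear_resolvent :: "(complex \<Rightarrow> complex) \<Rightarrow> real \<Rightarrow> complex \<Rightarrow> complex"
  where "nonlinear_resolvent f r z = (THE w. w \<in> unit_disc \<and> w + of_real r * f w = z)"

definition taylor_coeff :: "(complex \<Rightarrow> complex) \<Rightarrow> nat \<Rightarrow> complex"
  where "taylor_coeff h n = fps_nth (fps_expansion h 0) n"

definition fekete_szego :: "(complex \<Rightarrow> complex) \<Rightarrow> complex \<Rightarrow> complex"
  where "fekete_szego h l =
    taylor_coeff h 1 * taylor_coeff h 3 - l * (taylor_coeff h 2)\<^sup>2"

definition hadamard_product ::
    "(complex \<Rightarrow> complex) \<Rightarrow> (complex \<Rightarrow> complex) \<Rightarrow> complex \<Rightarrow> complex"
  where "hadamard_product f g z = (\<Sum>n. taylor_coeff f n * taylor_coeff g n * z ^ n)"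

definition class_frakA :: "real \<Rightarrow> (complex \<Rightarrow> complex) set"
  where "class_frakA \<alpha> = {f \<in> class_A. \<forall>z\<in>unit_disc - {0}.
    Re (of_real \<alpha> * (f z / z) + of_real (1 - \<alpha>) * deriv f z) \<ge> 0}"

definition class_frakA1 :: "real \<Rightarrow> (complex \<Rightarrow> complex) set"
  where "class_frakA1 \<alpha> = {f \<in> class_A. \<forall>z\<in>unit_disc.
    cmod (of_real \<alpha> * ext0 (\<lambda>z. f z / z) z + of_real (1 - \<alpha>) * deriv f z - 1) \<le> 2 - \<alpha>}"

(* The power is the principal branch, holomorphic on the disc since Re (1 - z) > 0 there.
   In this and the next class the denominator is required not to vanish off the origin, so
   that the quotient is not affected by the convention x / 0 = 0.  This excludes no function:
   near a further zero the quotient has a pole and the inequality fails (for class_frakL 1,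
   where the quotient has coefficient 0, it fails at the zero itself). *)
definition class_frakR :: "real \<Rightarrow> (complex \<Rightarrow> complex) set"
  where "class_frakR \<alpha> =
    (if \<alpha> = 1 then {f \<in> class_A. \<forall>z\<in>unit_disc - {0}. Re (f z / z) > 1/2}
     else {f \<in> class_A.
       let g = hadamard_product f (\<lambda>z. z / (1 - z) powr of_real (2 - 2 * \<alpha>)) in
         (\<forall>z\<in>unit_disc - {0}. g z \<noteq> 0) \<and>
         (\<forall>z\<in>unit_disc. Re (ext0 (\<lambda>z. z * deriv g z / g z) z) \<ge> \<alpha>)})"

definition class_frakL :: "real \<Rightarrow> (complex \<Rightarrow> complex) set"
  where "class_frakL \<alpha> = {f \<in> class_A. \<forall>z\<in>unit_disc - {0}. f z \<noteq> 0 \<and>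
    Re (of_real \<alpha> * (f z / z) + of_real (1 - \<alpha>) * (z * deriv f z / f z)) > 1/2}"

definition class_frakM :: "real \<Rightarrow> (complex \<Rightarrow> complex) set"
  where "class_frakM \<beta> = {f \<in> class_A.
    (\<forall>z\<in>unit_disc - {0}. f z * deriv f z \<noteq> 0) \<and>
    (\<forall>z\<in>unit_disc.
      Re (of_real \<beta> * ext0 (\<lambda>z. z * deriv f z / f z) z
          + of_real (1 - \<beta>) * (1 + z * deriv (deriv f) z / deriv f z)) > \<beta> / 2)}"

end

(* A Schwarz function w satisfies |w_2| <= 1 - |w_1|^2: divide by z and move the value at 0
   to 0 by a Moebius map.  By the Cayley transform, p = 1 + 2 c z + 2 (d + c^2) z^2 + ... with
   |d| <= 1 - |c|^2 whenever Re p >= 0 and p(0) = 1.  The condition defining each class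
   normalizes to such a p (or to a Schwarz function), so the second coefficient of f is a
   multiple of c and the third has the form B d + C c^2; then |B d + E c^2| <= max B |E|.
   For the resolvent, |w + r f(w)| >= |w|, because Re (f(w)/w) > 0; hence near 0 it coincides
   with the local inverse of w + r f(w), and its coefficients come from composing power series. *)
theory Submission
  imports Defs
begin

section \<open>Taylor coefficients on the unit disc\<close>

text \<open>The pair c, d is carried along because the functional couples the second and third
  coefficients through a complex parameter: bounding them separately would lose the trade-off |d| <=
  1 - |c|^2, and with it the maximum in each estimate. Quotients cause two difficulties: their
  formula is 0/0 at the origin, and their coefficients call for division of power series. Both are
  met by clearing denominators. An identity is multiplied out on the disc and its low coefficients
  are compared, while the value at the origin comes from a holomorphic q with f(z) = z q(z). Thus
  each class condition is evaluated only off the origin, and no limit is ever computed. The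
  resolvent is a definite description over the whole disc. Identifying it with the local inverse
  therefore means excluding every other solution in the disc, not only those near 0; this is where
  positivity of Re (f(w)/w) enters.\<close>

lemma has_fps_expansion_taylor:
  assumes "f holomorphic_on unit_disc"
  shows "f has_fps_expansion Abs_fps (taylor_coeff f)"
proof -
  have "Abs_fps (taylor_coeff f) = fps_expansion f 0"
    by (simp add: fps_eq_iff taylor_coeff_def)
  then show ?thesis
    using has_fps_expansion_fps_expansion[of unit_disc f] assms by simp
qed

lemma taylor_coeff_eqI: "f has_fps_expansion F \<Longrightarrow> taylor_coeff f n = fps_nth F n"
  by (simp add: taylor_coeff_def fps_expansion_eqI)

lemma taylor_coeff_0 [simp]: "taylor_coeff f 0 = f 0"
  by (simp add: taylor_coeff_def fps_expansion_def)

lemma taylor_coeff_1: "taylor_coeff f 1 = deriv f 0"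
  by (simp add: taylor_coeff_def fps_expansion_def)

text \<open>Transfers identities obtained by clearing a denominator, which are available only on the
  disc: elsewhere the denominator may vanish and division takes its default value.\<close>

lemma taylor_coeff_cong:
  assumes "\<And>z. z \<in> unit_disc \<Longrightarrow> f z = g z"
  shows "taylor_coeff f n = taylor_coeff g n"
proof -
  have "eventually (\<lambda>z. f z = g z) (nhds 0)"
    by (rule eventually_mono[OF eventually_nhds_in_open[of unit_disc]]) (use assms in auto)
  then show ?thesis
    by (simp add: taylor_coeff_def cong: fps_expansion_cong)
qed

lemma taylor_coeff_mult:
  assumes "f holomorphic_on unit_disc" "g holomorphic_on unit_disc"
  shows "taylor_coeff (\<lambda>z. f z * g z) n = (\<Sum>i=0..n. taylor_coeff f i * taylor_coeff g (n - i))"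
  using taylor_coeff_eqI[OF has_fps_expansion_mult[OF assms[THEN has_fps_expansion_taylor]]]
  by (simp add: fps_mult_nth)

lemma taylor_coeff_add:
  assumes "f holomorphic_on unit_disc" "g holomorphic_on unit_disc"
  shows "taylor_coeff (\<lambda>z. f z + g z) n = taylor_coeff f n + taylor_coeff g n"
  using taylor_coeff_eqI[OF has_fps_expansion_add[OF assms[THEN has_fps_expansion_taylor]]]
  by simp

lemma taylor_coeff_diff:
  assumes "f holomorphic_on unit_disc" "g holomorphic_on unit_disc"
  shows "taylor_coeff (\<lambda>z. f z - g z) n = taylor_coeff f n - taylor_coeff g n"
  using taylor_coeff_eqI[OF has_fps_expansion_diff[OF assms[THEN has_fps_expansion_taylor]]]
  by simp

lemma taylor_coeff_cmult:
  assumes "f holomorphic_on unit_disc"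
  shows "taylor_coeff (\<lambda>z. c * f z) n = c * taylor_coeff f n"
  using taylor_coeff_eqI[OF has_fps_expansion_cmult_left[OF assms[THEN has_fps_expansion_taylor]]]
  by simp

lemma taylor_coeff_const: "taylor_coeff (\<lambda>z. c) n = (if n = 0 then c else 0)"
  using taylor_coeff_eqI[OF has_fps_expansion_const] by simp

lemma taylor_coeff_deriv:
  assumes "f holomorphic_on unit_disc"
  shows "taylor_coeff (deriv f) n = of_nat (Suc n) * taylor_coeff f (Suc n)"
  using taylor_coeff_eqI[OF has_fps_expansion_deriv[OF assms[THEN has_fps_expansion_taylor]]]
  by simp

lemma taylor_coeff_times_ident:
  assumes "f holomorphic_on unit_disc"
  shows "taylor_coeff (\<lambda>z. z * f z) (Suc n) = taylor_coeff f n"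
  using taylor_coeff_eqI[OF has_fps_expansion_mult[OF has_fps_expansion_fps_X
        has_fps_expansion_taylor[OF assms]], of "Suc n"]
  by simp

section \<open>Schwarz and Caratheodory functions\<close>

text \<open>The maximum modulus principle. The constants of modulus one are split off because the
  Moebius map centred at such a value is degenerate.\<close>

lemma holomorphic_bounded_cases:
  assumes h: "h holomorphic_on unit_disc" and le: "\<forall>z\<in>unit_disc. cmod (h z) \<le> 1"
  obtains "\<forall>z\<in>unit_disc. cmod (h z) < 1"
    | c where "cmod c = 1" "\<forall>z\<in>unit_disc. h z = c"
proof (cases "\<exists>w\<in>unit_disc. cmod (h w) = 1")
  case True
  then obtain w where w: "w \<in> unit_disc" "cmod (h w) = 1" by blast
  have "h constant_on unit_disc"
    by (rule maximum_modulus_principle[OF h, of unit_disc w]) (use w le in auto)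
  then show ?thesis
    using that(2)[of "h w"] w unfolding constant_on_def by metis
next
  case False
  then show ?thesis
    using that(1) le by (meson order_le_less)
qed

lemma schwarz_pick_at_0:
  assumes h: "h holomorphic_on unit_disc" and le: "\<forall>z\<in>unit_disc. cmod (h z) \<le> 1"
  shows "cmod (taylor_coeff h 1) \<le> 1 - (cmod (h 0))\<^sup>2"
proof (cases rule: holomorphic_bounded_cases[OF assms])
  case 1
  define c where "c = h 0"
  define \<psi> where "\<psi> = (\<lambda>z. Moebius_function 0 c (h z))"
  have c: "cmod c < 1" using 1 by (simp add: c_def)
  have ne: "1 - cnj c * h z \<noteq> 0" if "z \<in> unit_disc" for z
  proof
    assume "1 - cnj c * h z = 0"
    then have "cmod c * cmod (h z) = 1"
      by (metis complex_mod_cnj eq_iff_diff_eq_0 norm_mult norm_one)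
    moreover have "cmod c * cmod (h z) < 1 * 1"
      by (rule mult_strict_mono') (use c 1 that in auto)
    ultimately show False by simp
  qed
  have \<psi>: "\<psi> holomorphic_on unit_disc"
    unfolding \<psi>_def Moebius_function_def using ne h by (auto intro!: holomorphic_intros)
  have "cmod (deriv \<psi> 0) \<le> 1"
  proof (rule Schwarz_Lemma(2)[OF \<psi>, of 0])
    show "\<psi> 0 = 0" by (simp add: \<psi>_def c_def Moebius_function_def)
    show "cmod (\<psi> z) < 1" if "cmod z < 1" for z
      unfolding \<psi>_def by (rule Moebius_function_norm_lt_1[OF c]) (use 1 that in auto)
  qed auto
  then have d: "cmod (taylor_coeff \<psi> 1) \<le> 1" by (simp only: taylor_coeff_1)
  \<comment> \<open>First-order comparison in \<psi> (1 - cnj c h) = h - c. Since \<psi> vanishes at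
    0, the only term left on the left is the first coefficient of \<psi> times 1 - |c|^2.\<close>
  have "taylor_coeff (\<lambda>z. \<psi> z * (1 - cnj c * h z)) 1 = taylor_coeff (\<lambda>z. h z - c) 1"
    by (rule taylor_coeff_cong) (use ne in \<open>auto simp: \<psi>_def Moebius_function_def\<close>)
  moreover have "\<psi> 0 = 0" by (simp add: \<psi>_def c_def Moebius_function_def)
  moreover have "(\<lambda>z. cnj c * h z) holomorphic_on unit_disc" using h by (intro holomorphic_intros)
  ultimately have "taylor_coeff \<psi> 1 * (1 - cnj c * c) = taylor_coeff h 1"
    using h \<psi> by (simp add: taylor_coeff_mult taylor_coeff_diff taylor_coeff_const holomorphic_intros c_def)
  also have "1 - cnj c * c = of_real (1 - (cmod c)\<^sup>2)"
    by (metis complex_norm_square mult.commute of_real_1 of_real_diff)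
  finally have "cmod (taylor_coeff h 1) = cmod (taylor_coeff \<psi> 1) * \<bar>1 - (cmod c)\<^sup>2\<bar>"
    by (metis norm_mult norm_of_real)
  also have "\<bar>1 - (cmod c)\<^sup>2\<bar> = 1 - (cmod c)\<^sup>2"
    using c by (simp add: abs_square_le_1)
  also have "cmod (taylor_coeff \<psi> 1) * (1 - (cmod c)\<^sup>2) \<le> 1 * (1 - (cmod c)\<^sup>2)"
    by (rule mult_right_mono[OF d]) (use c in \<open>simp add: abs_square_le_1\<close>)
  finally show ?thesis by (simp add: c_def)
next
  \<comment> \<open>For a constant of modulus one both sides of the inequality are 0.\<close>
  case (2 c)
  have "taylor_coeff h 1 = taylor_coeff (\<lambda>_. c) 1"
    by (rule taylor_coeff_cong) (use 2 in blast)
  then show ?thesis using 2 by (simp add: taylor_coeff_const)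
qed

lemma schwarz_coeff_2:
  assumes h: "\<omega> holomorphic_on unit_disc" and 0: "\<omega> 0 = 0"
    and le: "\<forall>z\<in>unit_disc. cmod (\<omega> z) \<le> 1"
  shows "cmod (taylor_coeff \<omega> 2) \<le> 1 - (cmod (taylor_coeff \<omega> 1))\<^sup>2"
proof -
  \<comment> \<open>\<open>Schwarz_Lemma\<close> asks for strict inequality; the value 0 at the
    origin rules out a constant of modulus one.\<close>
  have lt: "cmod (\<omega> z) < 1" if "cmod z < 1" for z
    by (cases rule: holomorphic_bounded_cases[OF assms(1,3)]) (use that 0 in force)+
  obtain \<phi> where \<phi>: "\<phi> holomorphic_on unit_disc"
    and eq: "\<And>z. cmod z < 1 \<Longrightarrow> \<omega> z = z * \<phi> z" and \<phi>0: "deriv \<omega> 0 = \<phi> 0"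
    using Schwarz3[OF h 0] by blast
  have "cmod (\<phi> z) \<le> 1" if "z \<in> unit_disc" for z
  proof (cases "z = 0")
    case True
    then show ?thesis using Schwarz_Lemma(2)[OF h 0 lt, of 0] \<phi>0 by simp
  next
    case False
    then show ?thesis
      using Schwarz_Lemma(1)[OF h 0 lt, of z] eq[of z] that by (simp add: norm_mult)
  qed
  with \<phi> have "cmod (taylor_coeff \<phi> 1) \<le> 1 - (cmod (\<phi> 0))\<^sup>2"
    by (intro schwarz_pick_at_0) auto
  moreover have "taylor_coeff \<omega> n = taylor_coeff (\<lambda>z. z * \<phi> z) n" for n
    by (rule taylor_coeff_cong) (simp add: eq)
  ultimately show ?thesis
    using taylor_coeff_times_ident[OF \<phi>, of 0] taylor_coeff_times_ident[OF \<phi>, of 1]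
    by (simp add: numeral_2_eq_2)
qed

text \<open>Here c and d are the first two coefficients of the Cayley transform \<omega>, read off
  from \<omega> (p + 1) = p - 1. The sign condition is asked only off the origin, where the
  quotients defining the classes need no limit; \<open>p 0 = 1\<close> covers the remaining
  point.\<close>

lemma caratheodory_coeffs:
  assumes p: "p holomorphic_on unit_disc" and 0: "p 0 = 1"
    and re: "\<And>z. z \<in> unit_disc \<Longrightarrow> z \<noteq> 0 \<Longrightarrow> Re (p z) \<ge> 0"
  obtains c d where "cmod d \<le> 1 - (cmod c)\<^sup>2"
    "taylor_coeff p 1 = 2 * c" "taylor_coeff p 2 = 2 * d + 2 * c\<^sup>2"
proof -
  define \<omega> where "\<omega> = (\<lambda>z. (p z - 1) / (p z + 1))"
  have re: "Re (p z) \<ge> 0" if "z \<in> unit_disc" for z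
    using re[OF that] 0 by (cases "z = 0") auto
  have ne: "p z + 1 \<noteq> 0" if "z \<in> unit_disc" for z
    using re[OF that] by (auto simp: complex_eq_iff)
  have \<omega>: "\<omega> holomorphic_on unit_disc"
    unfolding \<omega>_def using p ne by (auto intro!: holomorphic_intros)
  have \<omega>0: "\<omega> 0 = 0" by (simp add: \<omega>_def 0)
  have le: "cmod (\<omega> z) \<le> 1" if "z \<in> unit_disc" for z
  proof -
    \<comment> \<open>The difference |p + 1|^2 - |p - 1|^2 equals 4 Re p.\<close>
    have "(cmod (p z - 1))\<^sup>2 \<le> (cmod (p z + 1))\<^sup>2"
      unfolding cmod_power2 using re[OF that] by (simp add: power2_eq_square algebra_simps)
    then show ?thesis
      by (simp add: \<omega>_def norm_divide divide_le_eq_1 power2_le_iff_abs_le ne that)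
  qed
  have eq: "taylor_coeff (\<lambda>z. \<omega> z * (p z + 1)) n = taylor_coeff (\<lambda>z. p z - 1) n" for n
    by (rule taylor_coeff_cong) (use ne in \<open>auto simp: \<omega>_def\<close>)
  define c d where "c = taylor_coeff \<omega> 1" and "d = taylor_coeff \<omega> 2"
  have p1: "taylor_coeff p 1 = 2 * c"
    using eq[of 1] p \<omega> by (simp add: taylor_coeff_mult taylor_coeff_diff taylor_coeff_add
        taylor_coeff_const holomorphic_intros 0 \<omega>0 c_def mult.commute)
  have "taylor_coeff p 2 = 2 * d + c * taylor_coeff p 1"
    using eq[of 2] p \<omega> by (simp add: taylor_coeff_mult taylor_coeff_diff taylor_coeff_add
        taylor_coeff_const holomorphic_intros 0 \<omega>0 c_def d_def numeral_2_eq_2 mult.commute add.commute)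
  with p1 have "taylor_coeff p 2 = 2 * d + 2 * c\<^sup>2"
    by (simp add: power2_eq_square)
  with p1 schwarz_coeff_2[OF \<omega> \<omega>0] le show ?thesis
    using that[of d c] by (simp add: c_def d_def)
qed

text \<open>With x = |c|^2 in [0,1], the triangle inequality gives B (1 - x) + |E| x, a convex
  combination of B and |E|. This is the source of the maximum in all five estimates.\<close>

lemma fekete_szego_max_bound:
  assumes d: "cmod d \<le> 1 - (cmod c)\<^sup>2" and B: "B \<ge> 0"
  shows "cmod (of_real B * d + E * c\<^sup>2) \<le> max B (cmod E)"
proof -
  define x where "x = (cmod c)\<^sup>2"
  have x: "0 \<le> x" "x \<le> 1" using d norm_ge_zero[of d] unfolding x_def by (simp, linarith)
  have "cmod (of_real B * d + E * c\<^sup>2) \<le> B * cmod d + cmod E * x"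
    by (rule norm_triangle_le) (use B in \<open>simp add: norm_mult norm_power x_def\<close>)
  also have "\<dots> \<le> B * (1 - x) + cmod E * x"
    using d B by (simp add: x_def mult_left_mono)
  also have "\<dots> \<le> max B (cmod E) * (1 - x) + max B (cmod E) * x"
    by (intro add_mono mult_right_mono) (use x in auto)
  finally show ?thesis by (simp add: algebra_simps)
qed

section \<open>Coefficients in the function classes\<close>

lemma class_A_D:
  assumes "f \<in> class_A"
  shows "f holomorphic_on unit_disc" "f 0 = 0" "taylor_coeff f 1 = 1"
  using assms taylor_coeff_1[of f] by (auto simp: class_A_def)

lemma class_A_quotient:
  assumes f: "f \<in> class_A"
  obtains q where "q holomorphic_on unit_disc" "q 0 = 1"
    "\<And>z. z \<in> unit_disc \<Longrightarrow> f z = z * q z"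
    "\<And>n. taylor_coeff q n = taylor_coeff f (Suc n)"
proof -
  have d: "deriv f 0 = 1" using f by (simp add: class_A_def)
  obtain q where q: "q holomorphic_on unit_disc"
    and eq: "\<And>z. cmod z < 1 \<Longrightarrow> f z = z * q z" and q0: "deriv f 0 = q 0"
    using Schwarz3[OF class_A_D(1,2)[OF f]] by blast
  have "taylor_coeff f (Suc n) = taylor_coeff (\<lambda>z. z * q z) (Suc n)" for n
    by (rule taylor_coeff_cong) (simp add: eq)
  then show ?thesis
    using that[of q] q eq q0 d by (simp add: taylor_coeff_times_ident)
qed

text \<open>Writing f = z q turns z f'/f into f'/q, and q has no zeros in the disc. The coefficients
  come from s q = f': at orders 1 and 2 this reads s_1 + a_2 = 2 a_2 and s_2 + s_1 a_2 + a_3 = 3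
  a_3.\<close>

lemma class_A_log_deriv:
  assumes f: "f \<in> class_A" and nz: "\<And>z. z \<in> unit_disc \<Longrightarrow> z \<noteq> 0 \<Longrightarrow> f z \<noteq> 0"
  obtains s where "s holomorphic_on unit_disc" "s 0 = 1"
    "\<And>z. z \<in> unit_disc \<Longrightarrow> z \<noteq> 0 \<Longrightarrow> s z = z * deriv f z / f z"
    "taylor_coeff s 1 = taylor_coeff f 2"
    "taylor_coeff s 2 = 2 * taylor_coeff f 3 - (taylor_coeff f 2)\<^sup>2"
proof -
  obtain q where q: "q holomorphic_on unit_disc" "q 0 = 1"
    "\<And>z. z \<in> unit_disc \<Longrightarrow> f z = z * q z" "\<And>n. taylor_coeff q n = taylor_coeff f (Suc n)"
    using class_A_quotient[OF f] by blast
  have qnz: "q z \<noteq> 0" if "z \<in> unit_disc" for z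
    using q(2) q(3)[OF that] nz[OF that] by (cases "z = 0") auto
  define s where "s = (\<lambda>z. deriv f z / q z)"
  have hs: "s holomorphic_on unit_disc"
    unfolding s_def using qnz q(1) class_A_D(1)[OF f] by (auto intro!: holomorphic_intros)
  have s0: "s 0 = 1" using f q(2) by (simp add: s_def class_A_def)
  have "taylor_coeff (\<lambda>z. s z * q z) n = taylor_coeff (deriv f) n" for n
    by (rule taylor_coeff_cong) (use qnz in \<open>simp add: s_def\<close>)
  then have eq: "(\<Sum>i=0..n. taylor_coeff s i * taylor_coeff f (Suc (n - i))) =
      of_nat (Suc n) * taylor_coeff f (Suc n)" for n
    using q hs by (simp add: taylor_coeff_mult taylor_coeff_deriv class_A_D(1)[OF f])
  have f1: "taylor_coeff f (Suc 0) = 1" using class_A_D(3)[OF f] by simp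
  have s1: "taylor_coeff s 1 = taylor_coeff f 2"
    using eq[of 1] s0 f1 by (simp add: numeral_2_eq_2)
  have s2: "taylor_coeff s 2 = 2 * taylor_coeff f 3 - (taylor_coeff f 2)\<^sup>2"
    using eq[of 2] s0 f1 s1
    by (simp add: numeral_2_eq_2 numeral_3_eq_3 power2_eq_square algebra_simps)
  show ?thesis
    by (rule that[OF hs s0 _ s1 s2]) (use q in \<open>auto simp: s_def\<close>)
qed

section \<open>Classes defined by a linear combination of f(z)/z and f'(z)\<close>

lemma class_frakA_coeffs:
  assumes f: "f \<in> class_frakA \<alpha>" and \<alpha>: "\<alpha> \<le> 1"
  obtains c d where "cmod d \<le> 1 - (cmod c)\<^sup>2"
    "taylor_coeff f 2 = of_real (2 / (2 - \<alpha>)) * c"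
    "taylor_coeff f 3 = of_real (2 / (3 - 2 * \<alpha>)) * (d + c\<^sup>2)"
proof -
  have A: "f \<in> class_A" using f by (simp add: class_frakA_def)
  note hf = class_A_D[OF A]
  obtain q where q: "q holomorphic_on unit_disc" "q 0 = 1"
    "\<And>z. z \<in> unit_disc \<Longrightarrow> f z = z * q z" "\<And>n. taylor_coeff q n = taylor_coeff f (Suc n)"
    using class_A_quotient[OF A] by blast
  define p where "p = (\<lambda>z. of_real \<alpha> * q z + of_real (1 - \<alpha>) * deriv f z)"
  have hd: "deriv f holomorphic_on unit_disc" using hf by (simp add: holomorphic_deriv)
  have hp: "p holomorphic_on unit_disc"
    unfolding p_def using q hf(1) by (intro holomorphic_intros) auto
  \<comment> \<open>The multiplier is n + 1 - n \<alpha>; for n = 1, 2 it gives the constants 2 -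
    \<alpha> and 3 - 2 \<alpha>, both positive for \<alpha> \<le> 1.\<close>
  have tp: "taylor_coeff p n = of_real (\<alpha> + (1 - \<alpha>) * Suc n) * taylor_coeff f (Suc n)" for n
    unfolding p_def using q hd hf
    by (simp add: taylor_coeff_add taylor_coeff_cmult taylor_coeff_deriv holomorphic_intros)
      (simp add: algebra_simps)
  have p0: "p 0 = 1" using tp[of 0] hf(3) by simp
  have re: "Re (p z) \<ge> 0" if "z \<in> unit_disc" "z \<noteq> 0" for z
  proof -
    have "q z = f z / z" using q(3) that by simp
    then show ?thesis using f that unfolding class_frakA_def p_def by auto
  qed
  obtain c d where cd: "cmod d \<le> 1 - (cmod c)\<^sup>2" "taylor_coeff p 1 = 2 * c"
    "taylor_coeff p 2 = 2 * d + 2 * c\<^sup>2"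
    using caratheodory_coeffs[OF hp p0 re] by blast
  have "of_real (2 - \<alpha>) * taylor_coeff f 2 = 2 * c"
    using tp[of 1] cd(2) by (simp add: numeral_2_eq_2 algebra_simps)
  moreover have "of_real (3 - 2 * \<alpha>) * taylor_coeff f 3 = 2 * (d + c\<^sup>2)"
    using tp[of 2] cd(3) by (simp add: numeral_2_eq_2 numeral_3_eq_3 algebra_simps)
  moreover have "of_real (2 - \<alpha>) \<noteq> (0::complex)" "of_real (3 - 2 * \<alpha>) \<noteq> (0::complex)"
    using \<alpha> by (simp_all del: of_real_diff)
  ultimately show ?thesis
    using cd(1) that[of d c] by (simp add: field_simps)
qed

text \<open>The defining inequality yields a Schwarz function directly, without a Cayley transform,
  so a_3 has no c^2 term. The radius 2 - \<alpha> is also the multiplier of a_2, whence a_2 = c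
  exactly.\<close>

lemma class_frakA1_coeffs:
  assumes f: "f \<in> class_frakA1 \<alpha>" and \<alpha>: "\<alpha> \<le> 1"
  obtains c d where "cmod d \<le> 1 - (cmod c)\<^sup>2" "taylor_coeff f 2 = c"
    "taylor_coeff f 3 = of_real ((2 - \<alpha>) / (3 - 2 * \<alpha>)) * d"
proof -
  have A: "f \<in> class_A" using f by (simp add: class_frakA1_def)
  note hf = class_A_D[OF A]
  obtain q where q: "q holomorphic_on unit_disc" "q 0 = 1"
    "\<And>z. z \<in> unit_disc \<Longrightarrow> f z = z * q z" "\<And>n. taylor_coeff q n = taylor_coeff f (Suc n)"
    using class_A_quotient[OF A] by blast
  define \<kappa> where "\<kappa> = complex_of_real (1 / (2 - \<alpha>))"
  define w where "w = (\<lambda>z. \<kappa> * ((of_real \<alpha> * q z + of_real (1 - \<alpha>) * deriv f z) - 1))"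
  have hd: "deriv f holomorphic_on unit_disc" using hf by (simp add: holomorphic_deriv)
  have hw: "w holomorphic_on unit_disc"
    unfolding w_def using q hf(1) by (intro holomorphic_intros) auto
  have ne: "of_real (2 - \<alpha>) \<noteq> (0::complex)" "of_real (3 - 2 * \<alpha>) \<noteq> (0::complex)"
    using \<alpha> by (simp_all del: of_real_diff)
  \<comment> \<open>Order 0 is excluded because the subtracted constant 1 contributes there.\<close>
  have tw: "of_real (2 - \<alpha>) * taylor_coeff w n = of_real (\<alpha> + (1 - \<alpha>) * Suc n) * taylor_coeff f (Suc n)"
    if "n > 0" for n
  proof -
    have "taylor_coeff w n = \<kappa> * (of_real (\<alpha> + (1 - \<alpha>) * Suc n) * taylor_coeff f (Suc n))"
      unfolding w_def using q hd hf that
      by (simp add: taylor_coeff_add taylor_coeff_cmult taylor_coeff_deriv taylor_coeff_diff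
          taylor_coeff_const holomorphic_intros) (simp add: algebra_simps)
    moreover have "of_real (2 - \<alpha>) * \<kappa> = 1"
      using ne(1) by (simp add: \<kappa>_def)
    ultimately show ?thesis by (metis mult.assoc mult_1)
  qed
  have w0: "w 0 = 0" using A q by (simp add: w_def class_A_def)
  have le: "cmod (w z) \<le> 1" if "z \<in> unit_disc" for z
  proof (cases "z = 0")
    case False
    then have "q z = ext0 (\<lambda>z. f z / z) z" using q(3)[OF that] by (simp add: ext0_def)
    then have "cmod (of_real \<alpha> * q z + of_real (1 - \<alpha>) * deriv f z - 1) \<le> 2 - \<alpha>"
      using f that unfolding class_frakA1_def by auto
    then show ?thesis
      using \<alpha> unfolding w_def \<kappa>_def norm_mult norm_of_real by (simp add: field_simps)
  qed (simp add: w0)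
  have "of_real (2 - \<alpha>) * taylor_coeff f 2 = of_real (2 - \<alpha>) * taylor_coeff w 1"
    using tw[of 1] by (simp add: numeral_2_eq_2 algebra_simps)
  then have "taylor_coeff f 2 = taylor_coeff w 1"
    using ne(1) by (metis mult_left_cancel)
  moreover have "of_real (3 - 2 * \<alpha>) * taylor_coeff f 3 = of_real (2 - \<alpha>) * taylor_coeff w 2"
    using tw[of 2] by (simp add: numeral_2_eq_2 numeral_3_eq_3 algebra_simps)
  ultimately show ?thesis
    using schwarz_coeff_2[OF hw w0] le that ne(2) by (simp add: field_simps)
qed

section \<open>Hadamard products and prestarlike functions\<close>

lemma hadamard_product_taylor:
  assumes f: "f holomorphic_on unit_disc" and g: "g holomorphic_on unit_disc"
  shows "hadamard_product f g holomorphic_on unit_disc"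
    and "taylor_coeff (hadamard_product f g) n = taylor_coeff f n * taylor_coeff g n"
proof -
  define F where "F = Abs_fps (\<lambda>n. taylor_coeff f n * taylor_coeff g n)"
  have eq: "hadamard_product f g = eval_fps F"
    by (simp add: fun_eq_iff hadamard_product_def eval_fps_def F_def)
  have sums: "summable (\<lambda>n. norm (taylor_coeff h n * of_real t ^ n))"
    if h: "h holomorphic_on unit_disc" and t: "0 < t" "t < 1" for h and t :: real
  proof -
    have "ereal (norm (of_real t :: complex)) < 1"
      using t by (simp add: one_ereal_def)
    also have "1 \<le> fps_conv_radius (fps_expansion h 0)"
      by (rule conv_radius_fps_expansion) (use h in \<open>simp add: one_ereal_def\<close>)
    also have "\<dots> = conv_radius (taylor_coeff h)"
      by (simp add: fps_conv_radius_def taylor_coeff_def[abs_def])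
    finally show ?thesis by (rule abs_summable_in_conv_radius)
  qed
  have "fps_conv_radius F \<ge> 1"
    unfolding fps_conv_radius_def
  proof (rule conv_radius_geI_ex')
    fix t :: real assume t: "0 < t" "ereal t < 1"
    \<comment> \<open>The weight t^n is shared as u^n u^n between the factors: absolute summability
      at u is used for f, while for g it suffices that the terms at u are eventually below
      1.\<close>
    define u where "u = sqrt t"
    have u: "0 < u" "u < 1" "t = u * u" using t by (auto simp: u_def one_ereal_def)
    have "(\<lambda>n. norm (taylor_coeff g n * of_real u ^ n)) \<longlonglongrightarrow> 0"
      by (rule summable_LIMSEQ_zero[OF sums[OF g u(1,2)]])
    then have "eventually (\<lambda>n. norm (taylor_coeff g n * of_real u ^ n) < 1) sequentially"
      by (rule order_tendstoD) simp
    then have ev: "eventually (\<lambda>n. norm (fps_nth F n * of_real t ^ n)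
        \<le> norm (taylor_coeff f n * of_real u ^ n)) sequentially"
    proof eventually_elim
      case (elim n)
      have "fps_nth F n * of_real t ^ n =
          (taylor_coeff f n * of_real u ^ n) * (taylor_coeff g n * of_real u ^ n)"
        by (simp add: F_def u(3) power_mult_distrib)
      then have "norm (fps_nth F n * of_real t ^ n) =
          norm (taylor_coeff f n * of_real u ^ n) * norm (taylor_coeff g n * of_real u ^ n)"
        by (simp only: norm_mult)
      also have "\<dots> \<le> norm (taylor_coeff f n * of_real u ^ n)"
        by (rule mult_left_le) (use elim in auto)
      finally show ?case .
    qed
    show "summable (\<lambda>n. fps_nth F n * of_real t ^ n)"
      by (rule summable_comparison_test_ev[OF ev sums[OF f u(1,2)]])
  qed
  moreover have "ereal t < 1" if "t < 1" for t
    using that by (simp add: one_ereal_def)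
  ultimately have R: "ereal t < fps_conv_radius F" if "t < 1" for t
    using that by (metis order_less_le_trans)
  have R0: "fps_conv_radius F > 0"
    using R[of 0] by (simp add: zero_ereal_def)
  have R': "unit_disc \<subseteq> eball 0 (fps_conv_radius F)"
    using R by auto
  show "hadamard_product f g holomorphic_on unit_disc"
    unfolding eq by (rule holomorphic_on_eval_fps[OF R'])
  show "taylor_coeff (hadamard_product f g) n = taylor_coeff f n * taylor_coeff g n"
    using taylor_coeff_eqI[OF eval_fps_has_fps_expansion[OF R0]] by (simp add: eq F_def)
qed

text \<open>The factor h(z) = (1 - z)^(-s) solves (1 - z) h' = s h. Comparing coefficients gives h_1
  = s and 2 h_2 - h_1 = s h_1, and multiplication by z shifts the index by one.\<close>

lemma generalized_koebe_coeffs: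
  fixes s :: real
  defines "k \<equiv> \<lambda>z::complex. z / (1 - z) powr of_real s"
  shows "k holomorphic_on unit_disc" "taylor_coeff k 1 = 1" "taylor_coeff k 2 = of_real s"
    "taylor_coeff k 3 = of_real (s * (s + 1) / 2)"
proof -
  define h where "h = (\<lambda>z::complex. (1 - z) powr (- of_real s))"
  \<comment> \<open>On the disc 1 - z has positive real part, hence avoids the branch cut of the
    principal power.\<close>
  have re: "1 - z \<notin> \<real>\<^sub>\<le>\<^sub>0" if "z \<in> unit_disc" for z
    using complex_Re_le_cmod[of z] that by (auto simp: complex_nonpos_Reals_iff)
  have kh: "k = (\<lambda>z. z * h z)"
    by (simp add: k_def h_def fun_eq_iff powr_minus divide_inverse)
  have hh: "h holomorphic_on unit_disc"
    unfolding h_def using re by (intro holomorphic_intros) auto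
  then show "k holomorphic_on unit_disc" unfolding kh by (intro holomorphic_intros)
  have dh: "(1 - z) * deriv h z = of_real s * h z" if "z \<in> unit_disc" for z
  proof -
    have "(h has_field_derivative (- of_real s * (1 - z) powr (- of_real s - 1) * (-1))) (at z)"
      unfolding h_def using re[OF that] by (auto intro!: derivative_eq_intros)
    then have "deriv h z = of_real s * (1 - z) powr (- of_real s - 1)"
      by (simp add: DERIV_imp_deriv)
    moreover have "1 - z \<noteq> 0" using re[OF that] by auto
    ultimately show ?thesis by (simp add: h_def powr_diff)
  qed
  have "taylor_coeff (\<lambda>z. (1 - z) * deriv h z) n = taylor_coeff (\<lambda>z. of_real s * h z) n" for n
    by (rule taylor_coeff_cong) (rule dh)
  moreover have "taylor_coeff (\<lambda>z. (1 - z) * deriv h z) n =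
      taylor_coeff (deriv h) n - taylor_coeff (\<lambda>z. z * deriv h z) n" for n
    using hh by (subst taylor_coeff_diff[symmetric])
      (auto intro!: holomorphic_intros holomorphic_deriv simp: algebra_simps)
  ultimately have rec: "of_nat (Suc n) * taylor_coeff h (Suc n) - taylor_coeff (\<lambda>z. z * deriv h z) n =
      of_real s * taylor_coeff h n" for n
    using hh by (simp add: taylor_coeff_cmult taylor_coeff_deriv)
  have h0: "h 0 = 1" by (simp add: h_def)
  have h1: "taylor_coeff h 1 = of_real s"
    using rec[of 0] by (simp add: h0)
  have h2: "taylor_coeff h 2 = of_real (s * (s + 1) / 2)"
    using rec[of 1] h1 hh taylor_coeff_times_ident[of "deriv h" 0] taylor_coeff_1[of h]
    by (simp add: taylor_coeff_deriv holomorphic_deriv numeral_2_eq_2 field_simps)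
  have tk: "taylor_coeff k (Suc n) = taylor_coeff h n" for n
    unfolding kh by (rule taylor_coeff_times_ident[OF hh])
  show "taylor_coeff k 1 = 1" "taylor_coeff k 2 = of_real s"
    "taylor_coeff k 3 = of_real (s * (s + 1) / 2)"
    using tk[of 0] tk[of 1] tk[of 2] h0 h1 h2 by (simp_all add: numeral_2_eq_2 numeral_3_eq_3)
qed

text \<open>For \<alpha> < 1 the convolution multiplies a_2 by 2(1 - \<alpha>) and a_3 by (1 -
  \<alpha>)(3 - 2 \<alpha>). The common factor 1 - \<alpha> cancels against the normalization of Re
  (z g'/g) \<ge> \<alpha>. At \<alpha> = 1 this cancellation breaks down, so the separate definition
  is used with p = 2 f(z)/z - 1; the resulting formula is the same.\<close>

lemma class_frakR_coeffs:
  assumes f: "f \<in> class_frakR \<alpha>" and \<alpha>: "\<alpha> \<le> 1"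
  obtains c d where "cmod d \<le> 1 - (cmod c)\<^sup>2" "taylor_coeff f 2 = c"
    "taylor_coeff f 3 = of_real (1 / (3 - 2 * \<alpha>)) * d + c\<^sup>2"
proof (cases "\<alpha> = 1")
  case True
  have A: "f \<in> class_A" using f True by (simp add: class_frakR_def)
  obtain q where q: "q holomorphic_on unit_disc" "q 0 = 1"
    "\<And>z. z \<in> unit_disc \<Longrightarrow> f z = z * q z" "\<And>n. taylor_coeff q n = taylor_coeff f (Suc n)"
    using class_A_quotient[OF A] by blast
  define p where "p = (\<lambda>z. 2 * q z - 1)"
  have hp: "p holomorphic_on unit_disc"
    unfolding p_def using q by (intro holomorphic_intros) auto
  have p0: "p 0 = 1" by (simp add: p_def q)
  have re: "Re (p z) \<ge> 0" if "z \<in> unit_disc" "z \<noteq> 0" for z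
  proof -
    have "q z = f z / z" using q(3) that by simp
    then have "Re (q z) > 1/2" using f that True unfolding class_frakR_def by auto
    then show ?thesis by (simp add: p_def)
  qed
  obtain c d where cd: "cmod d \<le> 1 - (cmod c)\<^sup>2" "taylor_coeff p 1 = 2 * c"
    "taylor_coeff p 2 = 2 * d + 2 * c\<^sup>2"
    using caratheodory_coeffs[OF hp p0 re] by blast
  moreover have "taylor_coeff p n = 2 * taylor_coeff f (Suc n)" if "n > 0" for n
    unfolding p_def using q that
    by (simp add: taylor_coeff_diff taylor_coeff_cmult taylor_coeff_const holomorphic_intros)
  from this[of 1] this[of 2] cd
  have "2 * taylor_coeff f 2 = 2 * c" "2 * taylor_coeff f 3 = 2 * (d + c\<^sup>2)"
    by (simp_all add: numeral_2_eq_2 numeral_3_eq_3 distrib_left)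
  then have "taylor_coeff f 2 = c" "taylor_coeff f 3 = d + c\<^sup>2"
    by (metis mult_left_cancel zero_neq_numeral)+
  ultimately show ?thesis using that True by simp
next
  case False
  define k where "k = (\<lambda>z::complex. z / (1 - z) powr of_real (2 - 2 * \<alpha>))"
  define g where "g = hadamard_product f k"
  have A: "f \<in> class_A" using f False by (simp add: class_frakR_def)
  note hf = class_A_D[OF A]
  note k = generalized_koebe_coeffs[of "2 - 2 * \<alpha>", folded k_def]
  note hg = hadamard_product_taylor[OF hf(1) k(1), folded g_def]
  have *: "(\<forall>z\<in>unit_disc - {0}. g z \<noteq> 0) \<and>
      (\<forall>z\<in>unit_disc. Re (ext0 (\<lambda>z. z * deriv g z / g z) z) \<ge> \<alpha>)"
    using f False by (simp add: class_frakR_def Let_def g_def k_def)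
  then have gnz: "g z \<noteq> 0" if "z \<in> unit_disc" "z \<noteq> 0" for z
    using that by simp
  have gre: "Re (z * deriv g z / g z) \<ge> \<alpha>" if "z \<in> unit_disc" "z \<noteq> 0" for z
    using bspec[OF conjunct2[OF *] that(1)] that(2) by (simp add: ext0_def)
  have "g \<in> class_A"
    using hg(1) hg(2)[of 0] hg(2)[of 1] hf k(2) taylor_coeff_1[of g] by (simp add: class_A_def)
  then obtain s where s: "s holomorphic_on unit_disc" "s 0 = 1"
    "\<And>z. z \<in> unit_disc \<Longrightarrow> z \<noteq> 0 \<Longrightarrow> s z = z * deriv g z / g z"
    "taylor_coeff s 1 = taylor_coeff g 2"
    "taylor_coeff s 2 = 2 * taylor_coeff g 3 - (taylor_coeff g 2)\<^sup>2"
    using class_A_log_deriv gnz by blast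
  define \<kappa> where "\<kappa> = complex_of_real (1 / (1 - \<alpha>))"
  define p where "p = (\<lambda>z. \<kappa> * (s z - of_real \<alpha>))"
  have ne: "1 - \<alpha> > 0" "3 - 2 * \<alpha> > 0" using \<alpha> False by auto
  then have ne': "1 - of_real \<alpha> \<noteq> (0::complex)" "3 - 2 * of_real \<alpha> \<noteq> (0::complex)"
    using False by (auto simp: complex_eq_iff)
  have hp: "p holomorphic_on unit_disc"
    unfolding p_def using s by (intro holomorphic_intros) auto
  have p0: "p 0 = 1" using ne' by (simp add: p_def \<kappa>_def s field_simps)
  have re: "Re (p z) \<ge> 0" if "z \<in> unit_disc" "z \<noteq> 0" for z
    using gre[OF that] s(3)[OF that] ne(1) by (simp add: p_def \<kappa>_def del: of_real_divide)
  obtain c d where cd: "cmod d \<le> 1 - (cmod c)\<^sup>2" "taylor_coeff p 1 = 2 * c"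
    "taylor_coeff p 2 = 2 * d + 2 * c\<^sup>2"
    using caratheodory_coeffs[OF hp p0 re] by blast
  have ps: "(1 - of_real \<alpha>) * taylor_coeff p n = taylor_coeff s n" if "n > 0" for n
  proof -
    have "taylor_coeff p n = \<kappa> * taylor_coeff s n"
      unfolding p_def using s that
      by (simp add: taylor_coeff_diff taylor_coeff_cmult taylor_coeff_const holomorphic_intros)
    then show ?thesis using ne' by (simp add: \<kappa>_def)
  qed
  have "(1 - of_real \<alpha>) * (2 * c) = taylor_coeff f 2 * of_real (2 - 2 * \<alpha>)"
    using ps[of 1] cd(2) s(4) hg(2)[of 2] k(3) by simp
  also have "\<dots> = (1 - of_real \<alpha>) * (2 * taylor_coeff f 2)"
    by (simp add: algebra_simps)
  finally have "(1 - of_real \<alpha>) * (2 * c) = (1 - of_real \<alpha>) * (2 * taylor_coeff f 2)" .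
  then have f2: "taylor_coeff f 2 = c" using ne' by (metis mult_left_cancel zero_neq_numeral)
  \<comment> \<open>Order 2 of z g'/g involves 2 g_3 - g_2^2, where g_2^2 carries (1 - \<alpha>)^2.
    After one cancellation a multiple 2(1 - \<alpha>) c^2 remains; together with c^2 it makes (3 - 2
    \<alpha>) c^2, so c^2 enters a_3 with coefficient 1.\<close>
  have "(1 - of_real \<alpha>) * (2 * d + 2 * c\<^sup>2) =
      2 * (taylor_coeff f 3 * ((2 - 2 * of_real \<alpha>) * (3 - 2 * of_real \<alpha>) / 2)) -
      (c * (2 - 2 * of_real \<alpha>))\<^sup>2"
    using ps[of 2] cd(3) s(5) hg(2)[of 2] hg(2)[of 3] k(3,4) f2 by simp
  also have "\<dots> = (1 - of_real \<alpha>) *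
      (2 * (taylor_coeff f 3 * (3 - 2 * of_real \<alpha>) - 2 * (1 - of_real \<alpha>) * c\<^sup>2))"
    by (simp add: power2_eq_square field_simps)
  finally have "(1 - of_real \<alpha>) * (2 * (d + c\<^sup>2)) = (1 - of_real \<alpha>) *
      (2 * (taylor_coeff f 3 * (3 - 2 * of_real \<alpha>) - 2 * (1 - of_real \<alpha>) * c\<^sup>2))"
    by (simp only: distrib_left)
  then have "d + c\<^sup>2 = taylor_coeff f 3 * (3 - 2 * of_real \<alpha>) - 2 * (1 - of_real \<alpha>) * c\<^sup>2"
    using ne' by (metis mult_left_cancel zero_neq_numeral)
  then have "taylor_coeff f 3 = of_real (1 / (3 - 2 * \<alpha>)) * d + c\<^sup>2"
    using ne' by (simp add: field_simps)
  with f2 cd(1) show ?thesis using that by blast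
qed

section \<open>Classes built from z f'(z)/f(z)\<close>

lemma class_frakL_coeffs:
  assumes f: "f \<in> class_frakL \<alpha>" and \<alpha>: "\<alpha> < 2"
  obtains c d where "cmod d \<le> 1 - (cmod c)\<^sup>2" "taylor_coeff f 2 = c"
    "taylor_coeff f 3 = of_real (1 / (2 - \<alpha>)) * d + c\<^sup>2"
proof -
  have A: "f \<in> class_A" using f by (simp add: class_frakL_def)
  obtain q where q: "q holomorphic_on unit_disc" "q 0 = 1"
    "\<And>z. z \<in> unit_disc \<Longrightarrow> f z = z * q z" "\<And>n. taylor_coeff q n = taylor_coeff f (Suc n)"
    using class_A_quotient[OF A] by blast
  have nz: "f z \<noteq> 0" if "z \<in> unit_disc" "z \<noteq> 0" for z
    using f that by (auto simp: class_frakL_def)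
  obtain s where s: "s holomorphic_on unit_disc" "s 0 = 1"
    "\<And>z. z \<in> unit_disc \<Longrightarrow> z \<noteq> 0 \<Longrightarrow> s z = z * deriv f z / f z"
    "taylor_coeff s 1 = taylor_coeff f 2"
    "taylor_coeff s 2 = 2 * taylor_coeff f 3 - (taylor_coeff f 2)\<^sup>2"
    using class_A_log_deriv[OF A nz] by blast
  define p where "p = (\<lambda>z. 2 * (of_real \<alpha> * q z + of_real (1 - \<alpha>) * s z) - 1)"
  have hp: "p holomorphic_on unit_disc"
    unfolding p_def using q s by (intro holomorphic_intros) auto
  have p0: "p 0 = 1" by (simp add: p_def q s)
  have re: "Re (p z) \<ge> 0" if z: "z \<in> unit_disc" "z \<noteq> 0" for z
  proof -
    have "q z = f z / z" using q(3) z by simp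
    then have "Re (of_real \<alpha> * q z + of_real (1 - \<alpha>) * s z) > 1/2"
      using f z unfolding class_frakL_def s(3)[OF z] by auto
    moreover have "Re (2 * x - 1) \<ge> 0" if "Re x > 1/2" for x using that by simp
    ultimately show ?thesis unfolding p_def by blast
  qed
  obtain c d where cd: "cmod d \<le> 1 - (cmod c)\<^sup>2" "taylor_coeff p 1 = 2 * c"
    "taylor_coeff p 2 = 2 * d + 2 * c\<^sup>2"
    using caratheodory_coeffs[OF hp p0 re] by blast
  have tp: "taylor_coeff p n = 2 * (of_real \<alpha> * taylor_coeff f (Suc n) + of_real (1 - \<alpha>) * taylor_coeff s n)"
    if "n > 0" for n
    unfolding p_def using q s that
    by (simp add: taylor_coeff_diff taylor_coeff_add taylor_coeff_cmult taylor_coeff_const holomorphic_intros)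
  \<comment> \<open>Both f(z)/z and z f'(z)/f(z) have first coefficient a_2, so \<alpha> drops out
    at this order.\<close>
  have f2: "taylor_coeff f 2 = c"
    using tp[of 1] cd(2) s(4) by (simp add: numeral_2_eq_2 algebra_simps)
  have "2 * d + 2 * c\<^sup>2 = 2 * (of_real \<alpha> * taylor_coeff f 3 + of_real (1 - \<alpha>) * (2 * taylor_coeff f 3 - c\<^sup>2))"
    using tp[of 2] cd(3) s(5) f2 by (simp add: numeral_2_eq_2 numeral_3_eq_3)
  then have "2 * ((2 - of_real \<alpha>) * taylor_coeff f 3) = 2 * (d + (2 - of_real \<alpha>) * c\<^sup>2)"
    by (simp add: algebra_simps)
  then have "(2 - of_real \<alpha>) * taylor_coeff f 3 = d + (2 - of_real \<alpha>) * c\<^sup>2"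
    by (metis mult_left_cancel zero_neq_numeral)
  moreover have "2 - of_real \<alpha> \<noteq> (0::complex)" using \<alpha> by (auto simp: complex_eq_iff)
  ultimately have "taylor_coeff f 3 = of_real (1 / (2 - \<alpha>)) * d + c\<^sup>2"
    by (simp add: field_simps)
  with f2 cd(1) show ?thesis using that by blast
qed

text \<open>The expression 1 + z f''/f' is z g'/g for g(z) = z f'(z), again a normalized function
  without zeros off the origin. So \<open>class_A_log_deriv\<close> serves for both quotients, the
  second time with coefficients 2 a_2 and 3 a_3.\<close>

lemma class_frakM_coeffs:
  assumes f: "f \<in> class_frakM \<beta>" and \<beta>: "\<beta> < 3 / 2"
  obtains c d where "cmod d \<le> 1 - (cmod c)\<^sup>2" "taylor_coeff f 2 = c"
    "taylor_coeff f 3 = of_real ((2 - \<beta>) / (6 - 4 * \<beta>)) * d + c\<^sup>2"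
proof -
  have A: "f \<in> class_A" using f by (simp add: class_frakM_def)
  note hf = class_A_D[OF A]
  have nz: "f z \<noteq> 0" "deriv f z \<noteq> 0" if "z \<in> unit_disc" "z \<noteq> 0" for z
    using f that by (auto simp: class_frakM_def)
  obtain s where s: "s holomorphic_on unit_disc" "s 0 = 1"
    "\<And>z. z \<in> unit_disc \<Longrightarrow> z \<noteq> 0 \<Longrightarrow> s z = z * deriv f z / f z"
    "taylor_coeff s 1 = taylor_coeff f 2"
    "taylor_coeff s 2 = 2 * taylor_coeff f 3 - (taylor_coeff f 2)\<^sup>2"
    using class_A_log_deriv[OF A nz(1)] by blast
  define g where "g = (\<lambda>z. z * deriv f z)"
  have hd: "deriv f holomorphic_on unit_disc" using hf by (simp add: holomorphic_deriv)
  have hg: "g holomorphic_on unit_disc" unfolding g_def using hf(1) by (intro holomorphic_intros) auto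
  have tg: "taylor_coeff g (Suc n) = of_nat (Suc n) * taylor_coeff f (Suc n)" for n
    unfolding g_def by (simp only: taylor_coeff_times_ident[OF hd] taylor_coeff_deriv[OF hf(1)])
  have gA: "g \<in> class_A"
    using hg tg[of 0] hf(3) taylor_coeff_1[of g] by (simp add: class_A_def g_def)
  have dg: "deriv g z = deriv f z + z * deriv (deriv f) z" if "z \<in> unit_disc" for z
  proof -
    have "(deriv f has_field_derivative deriv (deriv f) z) (at z)"
      using hd that by (simp add: holomorphic_derivI)
    then show ?thesis
      unfolding g_def by (auto intro!: DERIV_imp_deriv derivative_eq_intros)
  qed
  have gnz: "g z \<noteq> 0" if "z \<in> unit_disc" "z \<noteq> 0" for z
    using nz that by (simp add: g_def)
  obtain t where t: "t holomorphic_on unit_disc" "t 0 = 1"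
    "\<And>z. z \<in> unit_disc \<Longrightarrow> z \<noteq> 0 \<Longrightarrow> t z = z * deriv g z / g z"
    "taylor_coeff t 1 = taylor_coeff g 2"
    "taylor_coeff t 2 = 2 * taylor_coeff g 3 - (taylor_coeff g 2)\<^sup>2"
    using class_A_log_deriv[OF gA gnz] by blast
  have g23: "taylor_coeff g 2 = 2 * taylor_coeff f 2" "taylor_coeff g 3 = 3 * taylor_coeff f 3"
    using tg[of 1] tg[of 2] by (simp_all add: numeral_2_eq_2 numeral_3_eq_3)
  have pos: "2 - \<beta> > 0" using \<beta> by simp
  have ne: "2 - of_real \<beta> \<noteq> (0::complex)" "6 - 4 * of_real \<beta> \<noteq> (0::complex)"
    using \<beta> by (auto simp: complex_eq_iff)
  \<comment> \<open>Doubling the expression and subtracting \<beta> makes the real part positive;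
    the value at 0 is then 2 - \<beta>, which \<kappa> normalizes to 1.\<close>
  define \<kappa> where "\<kappa> = complex_of_real (1 / (2 - \<beta>))"
  define p where "p = (\<lambda>z. \<kappa> * (2 * (of_real \<beta> * s z + of_real (1 - \<beta>) * t z) - of_real \<beta>))"
  have hp: "p holomorphic_on unit_disc"
    unfolding p_def using s t by (intro holomorphic_intros) auto
  have p0: "p 0 = 1" using ne by (simp add: p_def \<kappa>_def s t field_simps)
  have re: "Re (p z) \<ge> 0" if z: "z \<in> unit_disc" "z \<noteq> 0" for z
  proof -
    have "t z = 1 + z * deriv (deriv f) z / deriv f z"
      using t(3)[OF z] dg[OF z(1)] nz[OF z] z by (simp add: g_def field_simps)
    moreover have "s z = ext0 (\<lambda>z. z * deriv f z / f z) z"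
      using s(3)[OF z] z by (simp add: ext0_def)
    ultimately have "Re (of_real \<beta> * s z + of_real (1 - \<beta>) * t z) > \<beta> / 2"
      using f z unfolding class_frakM_def by auto
    moreover have "Re (p z) = (2 * Re (of_real \<beta> * s z + of_real (1 - \<beta>) * t z) - \<beta>) / (2 - \<beta>)"
      unfolding p_def \<kappa>_def by (simp add: diff_divide_distrib del: of_real_divide)
    ultimately show ?thesis using pos by simp
  qed
  obtain c d where cd: "cmod d \<le> 1 - (cmod c)\<^sup>2" "taylor_coeff p 1 = 2 * c"
    "taylor_coeff p 2 = 2 * d + 2 * c\<^sup>2"
    using caratheodory_coeffs[OF hp p0 re] by blast
  have tp: "(2 - of_real \<beta>) * taylor_coeff p n =
      2 * (of_real \<beta> * taylor_coeff s n + of_real (1 - \<beta>) * taylor_coeff t n)" if "n > 0" for n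
  proof -
    have "taylor_coeff p n = \<kappa> * (2 * (of_real \<beta> * taylor_coeff s n + of_real (1 - \<beta>) * taylor_coeff t n))"
      unfolding p_def using s t that
      by (simp add: taylor_coeff_diff taylor_coeff_add taylor_coeff_cmult taylor_coeff_const holomorphic_intros)
    then show ?thesis using ne by (simp add: \<kappa>_def)
  qed
  have "(2 - of_real \<beta>) * (2 * c) = (2 - of_real \<beta>) * (2 * taylor_coeff f 2)"
    using tp[of 1] cd(2) s(4) t(4) g23 by (simp add: algebra_simps)
  then have f2: "taylor_coeff f 2 = c" using ne by (metis mult_left_cancel zero_neq_numeral)
  have "(2 - of_real \<beta>) * (2 * d + 2 * c\<^sup>2) = 2 * (of_real \<beta> * (2 * taylor_coeff f 3 - c\<^sup>2)
      + of_real (1 - \<beta>) * (2 * (3 * taylor_coeff f 3) - (2 * c)\<^sup>2))"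
    using tp[of 2] cd(3) s(5) t(5) g23 f2 by simp
  then have "2 * ((2 - of_real \<beta>) * d + (6 - 4 * of_real \<beta>) * c\<^sup>2) = 2 * ((6 - 4 * of_real \<beta>) * taylor_coeff f 3)"
    by (simp add: power2_eq_square algebra_simps)
  then have "(2 - of_real \<beta>) * d + (6 - 4 * of_real \<beta>) * c\<^sup>2 = (6 - 4 * of_real \<beta>) * taylor_coeff f 3"
    by (metis mult_left_cancel zero_neq_numeral)
  then have "taylor_coeff f 3 = of_real ((2 - \<beta>) / (6 - 4 * \<beta>)) * d + c\<^sup>2"
    using ne(2) by (simp add: field_simps)
  with f2 cd(1) show ?thesis using that by blast
qed

section \<open>The resolvent\<close>

lemma nonlinear_resolvent_local:
  assumes f: "f \<in> class_G0" and r: "r > 0"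
  obtains U where "open U" "0 \<in> U" "nonlinear_resolvent f r holomorphic_on U"
    "\<And>z. z \<in> U \<Longrightarrow> nonlinear_resolvent f r z + of_real r * f (nonlinear_resolvent f r z) = z"
    "nonlinear_resolvent f r 0 = 0"
proof -
  have A: "f \<in> class_A" using f by (simp add: class_G0_def)
  note hf = class_A_D[OF A]
  define h where "h = (\<lambda>w. w + of_real r * f w)"
  have hh: "h holomorphic_on unit_disc" unfolding h_def using hf by (intro holomorphic_intros)
  have "(f has_field_derivative 1) (at 0)"
    using holomorphic_derivI[OF hf(1), of 0] A by (simp add: class_A_def)
  then have "(h has_field_derivative (1 + of_real r * 1)) (at 0)"
    unfolding h_def by (auto intro!: derivative_eq_intros)
  then have "deriv h 0 \<noteq> 0"
    using r by (simp add: DERIV_imp_deriv complex_eq_iff)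
  then obtain \<rho> where \<rho>: "\<rho> > 0" "ball 0 \<rho> \<subseteq> unit_disc" "inj_on h (ball 0 \<rho>)"
    using has_complex_derivative_locally_injective[OF hh, of 0] by auto
  have h\<rho>: "h holomorphic_on ball 0 \<rho>" using hh \<rho>(2) by (rule holomorphic_on_subset)
  obtain g where g: "g holomorphic_on h ` ball 0 \<rho>" "\<And>z. z \<in> ball 0 \<rho> \<Longrightarrow> g (h z) = z"
    using holomorphic_has_inverse[OF h\<rho> open_ball \<rho>(3)] by metis
  have grow: "cmod w \<le> cmod (h w)" if "w \<in> unit_disc" for w
  proof (cases "w = 0")
    case False
    define x where "x = f w / w"
    have "Re x > 0"
      using f that False by (auto simp: class_G0_def ext0_def x_def dest!: bspec[of _ _ w])
    then have "1 \<le> Re (1 + of_real r * x)" using r by simp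
    also have "\<dots> \<le> cmod (1 + of_real r * x)" by (rule complex_Re_le_cmod)
    finally have "cmod w * 1 \<le> cmod w * cmod (1 + of_real r * x)"
      by (intro mult_left_mono) auto
    also have "\<dots> = cmod (w * (1 + of_real r * x))" by (simp add: norm_mult)
    also have "w * (1 + of_real r * x) = h w"
      using False by (simp add: h_def x_def field_simps)
    finally show ?thesis by simp
  qed simp
  \<comment> \<open>The image of the ball provides a solution; intersecting with the ball itself
    gives |z| < \<rho>, so by \<open>grow\<close> every solution in the disc lies where h is
    injective.\<close>
  define U where "U = h ` ball 0 \<rho> \<inter> ball 0 \<rho>"
  have h0: "h 0 = 0" using hf by (simp add: h_def)
  have "open (h ` ball 0 \<rho>)" using h\<rho> \<rho>(3) by (intro open_mapping_thm3) auto
  then have U: "open U" "0 \<in> U" using \<rho>(1) h0 by (auto simp: U_def image_iff intro!: bexI[of _ 0])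
  have res: "nonlinear_resolvent f r z = g z \<and> h (g z) = z" if z: "z \<in> U" for z
  proof -
    obtain w where w: "w \<in> ball 0 \<rho>" "z = h w" using z by (auto simp: U_def)
    have "nonlinear_resolvent f r z = w"
      unfolding nonlinear_resolvent_def
    proof (rule the_equality)
      show "w \<in> unit_disc \<and> w + of_real r * f w = z" using w \<rho>(2) by (auto simp: h_def)
      fix v assume v: "v \<in> unit_disc \<and> v + of_real r * f v = z"
      then have "h v = z" by (simp add: h_def)
      then have "v \<in> ball 0 \<rho>" using grow[of v] v z by (auto simp: U_def)
      with \<open>h v = z\<close> w \<rho>(3) show "v = w" by (auto dest: inj_onD)
    qed
    with w g(2) show ?thesis by simp
  qed
  show ?thesis
  proof (rule that[OF U])
    have "g holomorphic_on U" using g(1) by (rule holomorphic_on_subset) (auto simp: U_def)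
    then show "nonlinear_resolvent f r holomorphic_on U"
      by (rule holomorphic_transform) (simp add: res)
    show "nonlinear_resolvent f r z + of_real r * f (nonlinear_resolvent f r z) = z" if "z \<in> U" for z
      using res[OF that] by (simp add: h_def)
    show "nonlinear_resolvent f r 0 = 0"
      using res[OF U(2)] g(2)[of 0] h0 \<rho>(1) by simp
  qed
qed

text \<open>These are the coefficients of z, z^2, z^3 in B + r (F o B) = z. The formal composition
  is legitimate because the resolvent vanishes at 0.\<close>

lemma nonlinear_resolvent_coeffs:
  fixes r :: real
  assumes f: "f \<in> class_G0" and r: "r > 0"
  defines "b \<equiv> taylor_coeff (nonlinear_resolvent f r)"
  shows "(1 + of_real r) * b 1 = 1"
    and "(1 + of_real r) * b 2 + of_real r * taylor_coeff f 2 * (b 1)\<^sup>2 = 0"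
    and "(1 + of_real r) * b 3 + of_real r * (2 * taylor_coeff f 2 * b 1 * b 2 + taylor_coeff f 3 * b 1 ^ 3) = 0"
proof -
  have A: "f \<in> class_A" using f by (simp add: class_G0_def)
  note hf = class_A_D[OF A]
  define F where "F = Abs_fps (taylor_coeff f)"
  define B where "B = Abs_fps b"
  obtain U where U: "open U" "0 \<in> U" "nonlinear_resolvent f r holomorphic_on U"
    "\<And>z. z \<in> U \<Longrightarrow> nonlinear_resolvent f r z + of_real r * f (nonlinear_resolvent f r z) = z"
    "nonlinear_resolvent f r 0 = 0"
    using nonlinear_resolvent_local[OF f r] by blast
  have "B = fps_expansion (nonlinear_resolvent f r) 0"
    by (simp add: fps_eq_iff B_def b_def taylor_coeff_def)
  then have B: "nonlinear_resolvent f r has_fps_expansion B"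
    using has_fps_expansion_fps_expansion[OF U(1,2,3)] by simp
  have B0: "fps_nth B 0 = 0" using U(5) by (simp add: B_def b_def)
  have F: "f has_fps_expansion F" unfolding F_def by (rule has_fps_expansion_taylor[OF hf(1)])
  have "(\<lambda>z. nonlinear_resolvent f r z + of_real r * (f \<circ> nonlinear_resolvent f r) z)
      has_fps_expansion B + fps_const (of_real r) * (F oo B)"
    by (intro fps_expansion_intros B F B0)
  \<comment> \<open>The resolvent equation is available only on U, which suffices because an
    expansion depends on the germ at 0 alone.\<close>
  also have "?this \<longleftrightarrow> (\<lambda>z. z) has_fps_expansion B + fps_const (of_real r) * (F oo B)"
    by (rule has_fps_expansion_cong)
      (use eventually_nhds_in_open[OF U(1,2)] U(4) in \<open>auto elim: eventually_mono\<close>)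
  finally have "B + fps_const (of_real r) * (F oo B) = fps_X"
    by (rule fps_expansion_unique_complex) (rule has_fps_expansion_fps_X)
  then have eq: "fps_nth B n + of_real r * fps_nth (F oo B) n = fps_nth fps_X n" for n
    by (metis fps_add_nth fps_mult_left_const_nth)
  have F': "fps_nth F 0 = 0" "fps_nth F (Suc 0) = 1" using hf by (simp_all add: F_def)
  have "b 0 = 0" using B0 by (simp add: B_def)
  note simps = fps_compose_nth numeral_2_eq_2 numeral_3_eq_3 F' B0 fps_mult_nth algebra_simps
  show b1: "(1 + of_real r) * b 1 = 1"
    using eq[of 1] \<open>b 0 = 0\<close> by (simp add: simps B_def)
  show "(1 + of_real r) * b 2 + of_real r * taylor_coeff f 2 * (b 1)\<^sup>2 = 0"
    using eq[of 2] \<open>b 0 = 0\<close> by (simp add: simps B_def) (simp add: F_def)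
  show "(1 + of_real r) * b 3 + of_real r * (2 * taylor_coeff f 2 * b 1 * b 2 + taylor_coeff f 3 * b 1 ^ 3) = 0"
    using eq[of 3] \<open>b 0 = 0\<close> by (simp add: simps B_def) (simp add: F_def algebra_simps)
qed

section \<open>The Fekete-Szego functional of the resolvent and its estimates\<close>

lemma fekete_szego_nonlinear_resolvent:
  fixes lam :: complex and r :: real
  assumes f: "f \<in> class_G0" and r: "r > 0"
  shows "fekete_szego (nonlinear_resolvent f r) lam =
    - (of_real (r / (1 + r) ^ 5) * fekete_szego f ((2 - lam) * of_real (r / (1 + r))))"
proof -
  define b where "b = taylor_coeff (nonlinear_resolvent f r)"
  define R a2 a3 where "R = 1 + complex_of_real r" and "a2 = taylor_coeff f 2" and "a3 = taylor_coeff f 3"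
  note co = nonlinear_resolvent_coeffs[OF f r, folded b_def a2_def a3_def R_def]
  have R: "R \<noteq> 0" using r by (auto simp: R_def complex_eq_iff)
  have b1: "b 1 = 1 / R" using co(1) R by (simp add: field_simps)
  have b2: "b 2 = - (of_real r * a2 / R ^ 3)"
  proof -
    have "R * b 2 = - (of_real r * a2 * (1 / R)\<^sup>2)"
      using co(2) unfolding b1 by (simp add: eq_neg_iff_add_eq_0)
    then show ?thesis using R by (simp add: field_simps power2_eq_square power3_eq_cube)
  qed
  have b3: "b 3 = - (of_real r * (2 * a2 * b 1 * b 2 + a3 * b 1 ^ 3)) / R"
    using co(3) R by (simp add: eq_neg_iff_add_eq_0 field_simps)
  have "taylor_coeff f 1 = 1" using f by (intro class_A_D) (simp add: class_G0_def)
  then have "fekete_szego f ((2 - lam) * of_real (r / (1 + r))) = a3 - (2 - lam) * (of_real r / R) * a2\<^sup>2"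
    by (simp add: fekete_szego_def a2_def a3_def R_def)
  moreover have "fekete_szego (nonlinear_resolvent f r) lam = b 1 * b 3 - lam * (b 2)\<^sup>2"
    by (simp add: fekete_szego_def b_def)
  \<comment> \<open>Both a_2^2 contributions carry r^2 / R^6: the cross term 2 a_2 b_1 b_2 inside
    b_3 gives the factor 2, and b_2^2 gives -lam. Extracting -r / R^5 leaves (2 - lam) r / R, and
    the sign disappears in the modulus.\<close>
  moreover have "b 1 * b 3 - lam * (b 2)\<^sup>2 =
      - (of_real r / R ^ 5 * (a3 - (2 - lam) * (of_real r / R) * a2\<^sup>2))"
    unfolding b3 b2 b1 using R by (simp add: field_simps power_numeral_reduce)
  ultimately show ?thesis by (simp add: R_def)
qed

theorem theorem6p10:
  fixes lam :: complex and f :: "complex \<Rightarrow> complex" and r :: real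
  assumes "f \<in> class_G0" and "r > 0"
  shows
   "cmod (fekete_szego (nonlinear_resolvent f r) lam)
      = r / (1 + r) ^ 5 * cmod (fekete_szego f ((2 - lam) * of_real (r / (1 + r))))
    \<and> (\<forall>\<alpha>::real. \<alpha> \<le> 1 \<longrightarrow> f \<in> class_frakA \<alpha> \<longrightarrow>
        cmod (fekete_szego (nonlinear_resolvent f r) lam)
          \<le> r / (1 + r) ^ 5 * max (2 / (3 - 2 * \<alpha>))
              (cmod (of_real (2 / (3 - 2 * \<alpha>))
                     - of_real (4 / (2 - \<alpha>)\<^sup>2) * of_real (r / (1 + r)) * (2 - lam))))
    \<and> (\<forall>\<alpha>::real. \<alpha> \<le> 1 \<longrightarrow> f \<in> class_frakA1 \<alpha> \<longrightarrow>
        cmod (fekete_szego (nonlinear_resolvent f r) lam)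
          \<le> r / (1 + r) ^ 5 * max ((2 - \<alpha>) / (3 - 2 * \<alpha>)) (r / (1 + r) * cmod (2 - lam)))
    \<and> (\<forall>\<alpha>::real. 0 \<le> \<alpha> \<and> \<alpha> \<le> 1 \<longrightarrow> f \<in> class_frakR \<alpha> \<longrightarrow>
        cmod (fekete_szego (nonlinear_resolvent f r) lam)
          \<le> r / (1 + r) ^ 5 * max (1 / (3 - 2 * \<alpha>))
              (cmod ((1 + of_real r * (lam - 1)) / of_real (1 + r))))
    \<and> (\<forall>\<alpha>::real. \<alpha> < 2 \<longrightarrow> f \<in> class_frakL \<alpha> \<longrightarrow>
        cmod (fekete_szego (nonlinear_resolvent f r) lam)
          \<le> r / (1 + r) ^ 5 * max (1 / (2 - \<alpha>))
              (cmod ((1 + of_real r * (lam - 1)) / of_real (1 + r))))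
    \<and> (\<forall>\<beta>::real. \<beta> < 3 / 2 \<longrightarrow> f \<in> class_frakM \<beta> \<longrightarrow>
        cmod (fekete_szego (nonlinear_resolvent f r) lam)
          \<le> r / (1 + r) ^ 5 * max ((2 - \<beta>) / (6 - 4 * \<beta>))
              (cmod ((1 + of_real r * (lam - 1)) / of_real (1 + r))))"
proof -
  define \<nu> where "\<nu> = (2 - lam) * of_real (r / (1 + r))"
  have f1: "taylor_coeff f 1 = 1" using assms by (intro class_A_D) (simp add: class_G0_def)
  have eq: "cmod (fekete_szego (nonlinear_resolvent f r) lam) = r / (1 + r) ^ 5 * cmod (fekete_szego f \<nu>)"
    using fekete_szego_nonlinear_resolvent[OF assms] assms(2)
    unfolding \<nu>_def by (simp add: norm_mult del: of_real_divide)
  \<comment> \<open>Each class only has to supply B and E in the decomposition of a_3 - \<nu>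
    a_2^2.\<close>
  have bound: "cmod (fekete_szego (nonlinear_resolvent f r) lam) \<le> r / (1 + r) ^ 5 * max B (cmod E)"
    if "taylor_coeff f 3 - \<nu> * (taylor_coeff f 2)\<^sup>2 = of_real B * d + E * c\<^sup>2"
      "cmod d \<le> 1 - (cmod c)\<^sup>2" "B \<ge> 0" for B d E c
    unfolding eq using fekete_szego_max_bound[OF that(2,3), of E] that(1) f1 assms(2)
    by (intro mult_left_mono) (simp_all add: fekete_szego_def)
  have R: "1 + complex_of_real r \<noteq> 0" using assms(2) by (auto simp: complex_eq_iff)
  \<comment> \<open>In the last three cases a_2 = c and a_3 = B d + c^2, so E = 1 - \<nu> does not
    depend on the class parameter.\<close>
  have \<nu>1: "(1 + of_real r * (lam - 1)) / of_real (1 + r) = 1 - \<nu>"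
    using R by (simp add: \<nu>_def field_simps)
  show ?thesis
  proof (intro conjI allI impI)
    show "cmod (fekete_szego (nonlinear_resolvent f r) lam)
      = r / (1 + r) ^ 5 * cmod (fekete_szego f ((2 - lam) * of_real (r / (1 + r))))"
      using eq by (simp only: \<nu>_def)
  next
    fix \<alpha> :: real assume a: "\<alpha> \<le> 1" "f \<in> class_frakA \<alpha>"
    obtain c d where cd: "cmod d \<le> 1 - (cmod c)\<^sup>2" "taylor_coeff f 2 = of_real (2 / (2 - \<alpha>)) * c"
      "taylor_coeff f 3 = of_real (2 / (3 - 2 * \<alpha>)) * (d + c\<^sup>2)"
      using class_frakA_coeffs[OF a(2,1)] by blast
    have "taylor_coeff f 3 - \<nu> * (taylor_coeff f 2)\<^sup>2 = of_real (2 / (3 - 2 * \<alpha>)) * d +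
      (of_real (2 / (3 - 2 * \<alpha>)) - of_real (4 / (2 - \<alpha>)\<^sup>2) * of_real (r / (1 + r)) * (2 - lam)) * c\<^sup>2"
      unfolding cd \<nu>_def by (simp add: power_mult_distrib power_divide add_divide_distrib algebra_simps)
    then show "cmod (fekete_szego (nonlinear_resolvent f r) lam)
          \<le> r / (1 + r) ^ 5 * max (2 / (3 - 2 * \<alpha>))
              (cmod (of_real (2 / (3 - 2 * \<alpha>))
                     - of_real (4 / (2 - \<alpha>)\<^sup>2) * of_real (r / (1 + r)) * (2 - lam)))"
      by (rule bound) (use cd a in auto)
  next
    fix \<alpha> :: real assume a: "\<alpha> \<le> 1" "f \<in> class_frakA1 \<alpha>"
    obtain c d where cd: "cmod d \<le> 1 - (cmod c)\<^sup>2" "taylor_coeff f 2 = c"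
      "taylor_coeff f 3 = of_real ((2 - \<alpha>) / (3 - 2 * \<alpha>)) * d"
      using class_frakA1_coeffs[OF a(2,1)] by blast
    \<comment> \<open>As a_3 is a multiple of d alone, c^2 enters only through a_2^2, and E =
      -\<nu>.\<close>
    have "taylor_coeff f 3 - \<nu> * (taylor_coeff f 2)\<^sup>2 =
      of_real ((2 - \<alpha>) / (3 - 2 * \<alpha>)) * d + (- \<nu>) * c\<^sup>2"
      by (simp add: cd)
    then have "cmod (fekete_szego (nonlinear_resolvent f r) lam)
          \<le> r / (1 + r) ^ 5 * max ((2 - \<alpha>) / (3 - 2 * \<alpha>)) (cmod (- \<nu>))"
      by (rule bound) (use cd a in auto)
    also have "cmod (- \<nu>) = r / (1 + r) * cmod (2 - lam)"
      using assms(2) by (simp add: \<nu>_def norm_mult del: of_real_divide)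
    finally show "cmod (fekete_szego (nonlinear_resolvent f r) lam)
          \<le> r / (1 + r) ^ 5 * max ((2 - \<alpha>) / (3 - 2 * \<alpha>)) (r / (1 + r) * cmod (2 - lam))" .
  next
    fix \<alpha> :: real assume a: "0 \<le> \<alpha> \<and> \<alpha> \<le> 1" "f \<in> class_frakR \<alpha>"
    obtain c d where "cmod d \<le> 1 - (cmod c)\<^sup>2" "taylor_coeff f 2 = c"
      "taylor_coeff f 3 = of_real (1 / (3 - 2 * \<alpha>)) * d + c\<^sup>2"
      using class_frakR_coeffs[of f \<alpha>] a by blast
    then show "cmod (fekete_szego (nonlinear_resolvent f r) lam)
          \<le> r / (1 + r) ^ 5 * max (1 / (3 - 2 * \<alpha>))
              (cmod ((1 + of_real r * (lam - 1)) / of_real (1 + r)))"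
      unfolding \<nu>1 using a by (intro bound[of _ d _ c]) (auto simp: algebra_simps)
  next
    fix \<alpha> :: real assume a: "\<alpha> < 2" "f \<in> class_frakL \<alpha>"
    obtain c d where "cmod d \<le> 1 - (cmod c)\<^sup>2" "taylor_coeff f 2 = c"
      "taylor_coeff f 3 = of_real (1 / (2 - \<alpha>)) * d + c\<^sup>2"
      using class_frakL_coeffs[OF a(2,1)] by blast
    then show "cmod (fekete_szego (nonlinear_resolvent f r) lam)
          \<le> r / (1 + r) ^ 5 * max (1 / (2 - \<alpha>))
              (cmod ((1 + of_real r * (lam - 1)) / of_real (1 + r)))"
      unfolding \<nu>1 using a by (intro bound[of _ d _ c]) (auto simp: algebra_simps)
  next
    fix \<beta> :: real assume a: "\<beta> < 3 / 2" "f \<in> class_frakM \<beta>"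
    obtain c d where "cmod d \<le> 1 - (cmod c)\<^sup>2" "taylor_coeff f 2 = c"
      "taylor_coeff f 3 = of_real ((2 - \<beta>) / (6 - 4 * \<beta>)) * d + c\<^sup>2"
      using class_frakM_coeffs[OF a(2,1)] by blast
    then show "cmod (fekete_szego (nonlinear_resolvent f r) lam)
          \<le> r / (1 + r) ^ 5 * max ((2 - \<beta>) / (6 - 4 * \<beta>))
              (cmod ((1 + of_real r * (lam - 1)) / of_real (1 + r)))"
      unfolding \<nu>1 using a by (intro bound[of _ d _ c]) (auto simp: algebra_simps)
  qed
qed

end
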